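(* For each integer $d\geq 3$, let $m_d=\sqrt{2\pi d}+1$. Then for each integer $d\geq 3$ there exists a positive constant $A_d$ (depending only on $d$) such that for all sufficiently large $n$ there is a covering of $S^{d-1}$ by $n$ zones of half-width $m_d\frac{\ln n}{n}$ such that no point of $S^{d-1}$ belongs to more than $A_d\ln n$ of the zones.
   Context: $S^{d-1}$ is the unit sphere centred at the origin of $\mathbb{R}^d$. A great sphere of $S^{d-1}$ is the intersection of $S^{d-1}$ with a hyperplane through the origin. A (spherical) zone of half-width $t$ is the set of points of $S^{d-1}$ at spherical (geodesic) distance at most $t$ from a great sphere; for $0<t\leq\pi/2$ it equals $\{x\in S^{d-1}:|\langle x,u\rangle|\leq\sin t\}$ for a unit vector $u$. A covering of $S^{d-1}$ by zones is a family of zones whose union is $S^{d-1}$. *)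

theory Defs
  imports "HOL-Analysis.Analysis"
begin

definition great_sphere :: "'a::euclidean_space set \<Rightarrow> bool" where
  "great_sphere G \<longleftrightarrow> (\<exists>u. u \<noteq> 0 \<and> G = sphere 0 1 \<inter> {x. u \<bullet> x = 0})"

text \<open>Geodesic distance; meaningful for points of the unit sphere only.\<close>

definition sph_dist :: "'a::euclidean_space \<Rightarrow> 'a \<Rightarrow> real" where
  "sph_dist x y = arccos (x \<bullet> y)"

text \<open>The infimum is over a nonempty compact set whenever the ambient dimension is at least 2.\<close>

definition sph_setdist :: "'a::euclidean_space \<Rightarrow> 'a set \<Rightarrow> real" where
  "sph_setdist x G = (INF y\<in>G. sph_dist x y)"

text \<open>\<^term>\<open>is_zone t Z\<close>: the set \<^term>\<open>Z\<close> is a zone of half-width \<^term>\<open>t\<close>.\<close>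

definition is_zone :: "real \<Rightarrow> 'a::euclidean_space set \<Rightarrow> bool" where
  "is_zone t Z \<longleftrightarrow> (\<exists>G. great_sphere G \<and> Z = {x \<in> sphere 0 1. sph_setdist x G \<le> t})"

definition m_const :: "nat \<Rightarrow> real" where
  "m_const d = sqrt (2 * pi * real d) + 1"

end

theory Submission
  imports Defs "HOL-Probability.Probability" "HOL-Real_Asymp.Real_Asymp"
begin

text \<open>
  Choose the \<open>n\<close> zones with independent random poles, uniform in direction, and put
  \<open>L = ln n / n\<close>. A zone of half-width close to \<open>m\<^sub>d L\<close> contains a given point with probability at
  least \<open>(d - 1) L\<close>, so the point is missed by all zones with probability at most \<open>n\<^bsup>-(d-1)\<^esup>\<close>. An
  \<open>L/4\<close>-net of the sphere has only \<open>O(L\<^bsup>-(d-1)\<^esup>)\<close> points, so the expected number of missed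
  net points is \<open>O((ln n)\<^bsup>-(d-1)\<^esup>)\<close>; the \<open>+ 1\<close> in \<open>m\<^sub>d\<close> pays for passing from the net to the
  whole sphere. Conversely a slightly wider zone contains a given point with probability \<open>O(L)\<close>, and
  an exponential moment bound shows that no net point is in more than \<open>A ln n\<close> of them.
  Instead of independent random choices, the poles are picked one after the other by the
  method of conditional expectations, which needs no product measure.
\<close>

section \<open>Sequential choice by conditional expectations\<close>

text \<open>A value at most the mean is attained on every set of full measure, so each new entry can
  keep the weighted sum below its conditional expectation and still satisfy \<open>P\<close> and
  \<open>R\<close>. The weights are arbitrary because the induction changes them. The newest entry
  is the head of the list, hence the order of arguments in \<open>R u v\<close>.\<close>

lemma (in prob_space) exists_list_sum_prod_le:
  fixes \<phi> :: "'j \<Rightarrow> 'a \<Rightarrow> real"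
  assumes "finite J"
    and int: "\<And>j. j \<in> J \<Longrightarrow> integrable M (\<phi> j)"
    and nonneg: "\<And>j u. j \<in> J \<Longrightarrow> 0 \<le> \<phi> j u"
    and le: "\<And>j. j \<in> J \<Longrightarrow> expectation (\<phi> j) \<le> c j"
    and P: "AE u in M. P u" and R: "\<And>v. AE u in M. R u v"
    and w: "\<And>j. j \<in> J \<Longrightarrow> 0 \<le> w j"
  shows "\<exists>us. length us = n \<and> (\<forall>u\<in>set us. P u) \<and> sorted_wrt R us \<and>
           (\<Sum>j\<in>J. w j * prod_list (map (\<phi> j) us)) \<le> (\<Sum>j\<in>J. w j * c j ^ n)"
  using w
proof (induction n arbitrary: w)
  case 0
  show ?case by (rule exI[of _ "[]"]) simp
next
  case (Suc n)
  have c: "0 \<le> c j" if "j \<in> J" for j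
    using nonneg[OF that] by (intro order_trans[OF Bochner_Integration.integral_nonneg le[OF that]])
  \<comment> \<open>The extra weight \<open>c j\<close> stands in for the factor of the entry
    \<open>u\<close> that is still to be chosen.\<close>
  obtain us where us: "length us = n" "\<forall>u\<in>set us. P u" "sorted_wrt R us"
    "(\<Sum>j\<in>J. w j * c j * prod_list (map (\<phi> j) us)) \<le> (\<Sum>j\<in>J. w j * c j * c j ^ n)"
    using Suc.IH[of "\<lambda>j. w j * c j"] Suc.prems c by auto
  define f where "f u = (\<Sum>j\<in>J. w j * prod_list (map (\<phi> j) us) * \<phi> j u)" for u
  define B where "B = (\<Sum>j\<in>J. w j * prod_list (map (\<phi> j) us) * c j)"
  have pr: "0 \<le> prod_list (map (\<phi> j) us)" if "j \<in> J" for j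
    using nonneg[OF that] by (induction us) auto
  have intf: "integrable M f"
    unfolding f_def using int by (intro Bochner_Integration.integrable_sum integrable_mult_right) auto
  have "expectation f = (\<Sum>j\<in>J. w j * prod_list (map (\<phi> j) us) * expectation (\<phi> j))"
    unfolding f_def using int by (subst Bochner_Integration.integral_sum) auto
  also have "\<dots> \<le> B"
    unfolding B_def using le pr Suc.prems by (intro sum_mono mult_left_mono) auto
  finally have fB: "expectation f \<le> B" .
  have ae: "AE u in M. P u \<and> (\<forall>v\<in>set us. R u v)"
    using P R by (simp add: AE_finite_all)
  have "\<exists>u. P u \<and> (\<forall>v\<in>set us. R u v) \<and> f u \<le> B"
  proof (rule ccontr)
    assume no: "\<not> ?thesis"
    from ae have "AE u in M. B < f u"
      by eventually_elim (use no in force)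
    then show False
      using expectation_greater[OF intf] fB by force
  qed
  then obtain u where u: "P u" "\<forall>v\<in>set us. R u v" "f u \<le> B"
    by blast
  have "(\<Sum>j\<in>J. w j * prod_list (map (\<phi> j) (u # us))) = f u"
    unfolding f_def by (intro sum.cong) auto
  also have "\<dots> \<le> (\<Sum>j\<in>J. w j * c j ^ Suc n)"
    using u(3) us(4) unfolding B_def by (simp add: mult_ac)
  finally show ?case
    using u us by (intro exI[of _ "u # us"]) auto
qed

section \<open>Zones in terms of inner products\<close>

text \<open>With \<open>p\<close> the projection of \<open>x\<close> to the hyperplane,
  \<open>x\<close> and \<open>p\<close> have the same inner products with points of the great
  sphere. By Cauchy-Schwarz the nearest point is \<open>p\<close> normalised, at distance
  \<open>arccos (norm p)\<close>, and \<open>norm p\<close> is determined by Pythagoras.\<close>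

lemma sph_setdist_le_iff:
  fixes u x :: "'a::euclidean_space"
  assumes dim: "2 \<le> DIM('a)" and u: "norm u = 1" and x: "norm x = 1" and t: "0 \<le> t" "t \<le> pi / 2"
  shows "sph_setdist x (sphere 0 1 \<inter> {y. u \<bullet> y = 0}) \<le> t \<longleftrightarrow> \<bar>x \<bullet> u\<bar> \<le> sin t"
proof -
  define G where "G = sphere 0 1 \<inter> {y. u \<bullet> y = 0}"
  define p where "p = x - (x \<bullet> u) *\<^sub>R u"
  have uu: "u \<bullet> u = 1" "x \<bullet> x = 1" using u x by (simp_all add: dot_square_norm)
  have pu: "p \<bullet> u = 0" by (simp add: p_def inner_diff_left uu)
  have pn: "(norm p)\<^sup>2 = 1 - (x \<bullet> u)\<^sup>2"
    unfolding power2_norm_eq_inner p_def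
    by (simp add: inner_diff_left inner_diff_right uu power2_eq_square inner_commute)
  have p1: "norm p \<le> 1" using pn abs_square_le_1[of "norm p"] by simp
  have xy: "x \<bullet> y = p \<bullet> y" "x \<bullet> y \<le> norm p" "- norm p \<le> x \<bullet> y" if "y \<in> G" for y
  proof -
    from that have y: "norm y = 1" "u \<bullet> y = 0" by (auto simp: G_def)
    show e: "x \<bullet> y = p \<bullet> y" by (simp add: p_def inner_diff_left y)
    show "x \<bullet> y \<le> norm p" "- norm p \<le> x \<bullet> y"
      using Cauchy_Schwarz_ineq2[of p y] y e by auto
  qed
  obtain y where y: "y \<in> G" "x \<bullet> y = norm p"
  proof (cases "p = 0")
    case False
    have "p /\<^sub>R norm p \<in> G" using False pu by (simp add: G_def inner_commute)
    moreover have "x \<bullet> (p /\<^sub>R norm p) = norm p"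
      using xy(1)[OF calculation] False by (simp add: dot_square_norm power2_eq_square)
    ultimately show ?thesis using that by blast
  next
    \<comment> \<open>Here \<open>x\<close> is \<open>u\<close> or \<open>- u\<close> and all points
      of \<open>G\<close> are equally far from it; \<open>dim\<close> guarantees that there is
      one.\<close>
    case True
    obtain z where z: "z \<noteq> 0" "orthogonal u z"
      using orthogonal_to_vector_exists[OF dim] by metis
    have "z /\<^sub>R norm z \<in> G" using z by (simp add: G_def orthogonal_def)
    with xy(1)[OF this] True show ?thesis using that by auto
  qed
  have "sph_setdist x G = arccos (norm p)"
    unfolding sph_setdist_def sph_dist_def
  proof (rule cInf_eq_minimum)
    show "arccos (norm p) \<in> (\<lambda>y. arccos (x \<bullet> y)) ` G" using y by force
  next
    fix w assume "w \<in> (\<lambda>y. arccos (x \<bullet> y)) ` G"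
    then obtain z where z: "w = arccos (x \<bullet> z)" "z \<in> G" by blast
    with xy[OF z(2)] p1 show "arccos (norm p) \<le> w"
      by (auto intro: arccos_le_arccos)
  qed
  have "arccos (norm p) \<le> t \<longleftrightarrow> cos t \<le> norm p"
    using arccos_le_mono[of "norm p" "cos t"] p1 t by (simp add: arccos_cos)
  also have "\<dots> \<longleftrightarrow> (cos t)\<^sup>2 \<le> (norm p)\<^sup>2"
    using t by (intro power_mono_iff[symmetric]) (auto simp: cos_ge_zero)
  also have "\<dots> \<longleftrightarrow> (x \<bullet> u)\<^sup>2 \<le> (sin t)\<^sup>2"
    using pn by (simp add: cos_squared_eq)
  also have "\<dots> \<longleftrightarrow> \<bar>x \<bullet> u\<bar> \<le> sin t"
    using t by (simp add: abs_le_square_iff[symmetric] sin_ge_zero)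
  finally show ?thesis
    using \<open>sph_setdist x G = arccos (norm p)\<close> by (simp add: G_def)
qed

text \<open>The parameter \<open>r\<close> is the sine of the half-width. The factor
  \<open>norm u\<close> makes the set depend on the direction of \<open>u\<close> only, so that any
  nonzero vector of the ball can serve as a pole.\<close>

definition zone :: "real \<Rightarrow> 'a::euclidean_space \<Rightarrow> 'a set" where
  "zone r u = {x \<in> sphere 0 1. \<bar>x \<bullet> u\<bar> \<le> r * norm u}"

lemma is_zone_zone:
  fixes u :: "'a::euclidean_space"
  assumes dim: "2 \<le> DIM('a)" and u: "u \<noteq> 0" and t: "0 \<le> t" "t \<le> pi / 2"
  shows "is_zone t (zone (sin t) u)"
proof -
  define v where "v = u /\<^sub>R norm u"
  have v: "norm v = 1" using u by (simp add: v_def)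
  have "\<bar>x \<bullet> v\<bar> \<le> sin t \<longleftrightarrow> \<bar>x \<bullet> u\<bar> \<le> sin t * norm u" for x
    using u by (simp add: v_def abs_mult field_simps)
  then have "zone (sin t) u = {x \<in> sphere 0 1. sph_setdist x (sphere 0 1 \<inter> {y. v \<bullet> y = 0}) \<le> t}"
    using sph_setdist_le_iff[OF dim v _ t] by (auto simp: zone_def)
  then show ?thesis
    unfolding is_zone_def great_sphere_def
    by (intro exI[of _ "sphere 0 1 \<inter> {y. v \<bullet> y = 0}"] conjI exI[of _ v]) (use v in auto)
qed

text \<open>The covering is a set of zones, so it has \<open>n\<close> elements only if the zones
  are distinct. This reduces distinctness to non-parallel poles, which holds almost surely. For
  non-parallel poles a separating point exists in the plane that they span.\<close>

lemma zone_eq_imp_parallel: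
  fixes u v :: "'a::euclidean_space"
  assumes eq: "zone r u = zone r v" and r: "0 < r" "r < 1" and "u \<noteq> 0" "v \<noteq> 0"
  shows "u \<in> span {v}"
proof (rule ccontr)
  assume npar: "u \<notin> span {v}"
  define a where "a = u /\<^sub>R norm u"
  \<comment> \<open>Replacing a pole by its negative does not change the zone, so the angle between
    \<open>a\<close> and \<open>b\<close> may be taken acute or right.\<close>
  define b where "b = (if a \<bullet> v \<ge> 0 then v /\<^sub>R norm v else - (v /\<^sub>R norm v))"
  have ab: "a \<bullet> a = 1" "b \<bullet> b = 1" 
    using assms by (auto simp: a_def b_def dot_square_norm power2_eq_square)
  have za: "\<bar>x \<bullet> a\<bar> \<le> r \<longleftrightarrow> \<bar>x \<bullet> u\<bar> \<le> r * norm u" for x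
    using assms by (simp add: a_def abs_mult field_simps)
  have zb: "\<bar>x \<bullet> b\<bar> \<le> r \<longleftrightarrow> \<bar>x \<bullet> v\<bar> \<le> r * norm v" for x
    using assms by (simp add: b_def abs_mult field_simps)
  have iff: "\<bar>x \<bullet> a\<bar> \<le> r \<longleftrightarrow> \<bar>x \<bullet> b\<bar> \<le> r" if "x \<bullet> x = 1" for x
    using eq that za zb unfolding zone_def set_eq_iff by (auto simp: norm_eq_1)
  define c where "c = a \<bullet> b"
  have c0: "c \<ge> 0" by (auto simp: c_def b_def mult_nonneg_nonpos)
  define q where "q = a - c *\<^sub>R b"
  have "q \<noteq> 0"
  proof
    assume "q = 0"
    then have "u = (norm u * c) *\<^sub>R b"
      using \<open>u \<noteq> 0\<close> by (simp add: q_def a_def) (metis divideR_right norm_eq_zero scaleR_scaleR)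
    moreover have "b \<in> span {v}" by (auto simp: b_def span_base intro!: span_neg span_mul)
    ultimately show False using npar by (metis span_mul)
  qed
  have qq: "q \<bullet> q = 1 - c\<^sup>2"
    by (simp add: q_def c_def inner_diff_left inner_diff_right ab power2_eq_square inner_commute)
  have "q \<bullet> q > 0" using \<open>q \<noteq> 0\<close> by simp
  with qq have c21: "c\<^sup>2 < 1" by simp
  then have c1: "c < 1" using c0 by (simp add: abs_square_less_1)
  \<comment> \<open>Otherwise \<open>a\<close> itself would lie in the zone of \<open>b\<close> but
    not in its own.\<close>
  have cr: "r < c" 
  proof (rule ccontr)
    assume "\<not> r < c"
    with iff[of a] c0 ab r show False by (simp add: c_def)
  qed
  define s where "s = sqrt (1 - c\<^sup>2)"
  define k where "k = sqrt (1 - r\<^sup>2)"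
  have s: "s > 0" "s * s = 1 - c\<^sup>2" using c21 by (auto simp: s_def)
  have r2: "r\<^sup>2 < 1" using r by (simp add: abs_square_less_1)
  have k: "k > 0" "k * k = 1 - r\<^sup>2" using r2 by (auto simp: k_def)
  have ks: "s \<le> k" unfolding s_def k_def using cr r by (intro real_sqrt_le_mono) (simp add: power_mono)
  \<comment> \<open>This is the boundary point of the zone of \<open>b\<close> on the side of
    \<open>a\<close>; it turns out to lie outside the zone of \<open>a\<close>.\<close>
  define x where "x = r *\<^sub>R b + (k / s) *\<^sub>R q"
  have qb: "q \<bullet> b = 0" "b \<bullet> q = 0" by (simp_all add: q_def c_def inner_diff_left inner_diff_right ab inner_commute)
  have qa: "q \<bullet> a = 1 - c\<^sup>2" by (simp add: q_def c_def inner_diff_left ab power2_eq_square inner_commute[of b a])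
  have "x \<bullet> x = r\<^sup>2 + (k / s)\<^sup>2 * (1 - c\<^sup>2)"
    by (simp add: x_def inner_add_left inner_add_right qb qq ab power2_eq_square)
  also have "(k / s)\<^sup>2 * (1 - c\<^sup>2) = k * k" unfolding s(2)[symmetric] using s(1) by (simp add: power2_eq_square)
  finally have xx: "x \<bullet> x = 1" using k by simp
  have xb: "x \<bullet> b = r" by (simp add: x_def inner_add_left qb ab)
  have xa: "x \<bullet> a = r * c + k * s"
    using s(1) by (simp add: x_def inner_add_left qa flip: s(2)) (simp add: c_def inner_commute[of b a])
  have "r * (1 - c) < (1 + c) * (1 - c)" using r c0 c1 by (intro mult_strict_right_mono) auto
  also have "\<dots> = s * s" using s by (simp add: algebra_simps power2_eq_square)
  also have "\<dots> \<le> k * s" using ks s(1) by (intro mult_right_mono) auto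
  finally have "r < x \<bullet> a" unfolding xa by (simp add: algebra_simps)
  with iff[OF xx] xb r show False by simp
qed

section \<open>Volumes of slabs in the unit ball\<close>

text \<open>Log-convexity of Gamma at the midpoint \<open>x = (d + 1) / 2\<close> of
  \<open>x - 1/2\<close> and \<open>x + 1/2\<close>. This is the origin of the constant in
  \<open>m_const\<close>: \<open>sqrt (2 * pi * d)\<close> times this ratio bound is exactly
  \<open>d\<close>.\<close>

lemma unit_ball_vol_ratio:
  assumes "d > 0"
  shows "sqrt (real d / (2 * pi)) * unit_ball_vol (real d) \<le> unit_ball_vol (real (d - 1))"
proof -
  define x where "x = (real d + 1) / 2"
  have x: "x \<ge> 1" using assms by (simp add: x_def)
  have pos: "Gamma (x - 1/2) > 0" "Gamma x > 0" "Gamma (x + 1/2) > 0" using x by auto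
  have "(ln \<circ> Gamma) ((1 - 1/2) *\<^sub>R (x - 1/2) + (1/2) *\<^sub>R (x + 1/2))
      \<le> (1 - 1/2) * (ln \<circ> Gamma) (x - 1/2) + (1/2) * (ln \<circ> Gamma) (x + 1/2)"
    using x by (intro convex_onD[OF log_convex_Gamma_real]) auto
  also have "(1 - 1/2) *\<^sub>R (x - 1/2) + (1/2) *\<^sub>R (x + 1/2) = x" by (simp add: algebra_simps)
  finally have "2 * ln (Gamma x) \<le> ln (Gamma (x - 1/2)) + ln (Gamma (x + 1/2))" by simp
  then have "ln ((Gamma x)\<^sup>2) \<le> ln (Gamma (x - 1/2) * Gamma (x + 1/2))"
    using pos by (simp add: ln_mult ln_realpow)
  then have "(Gamma x)\<^sup>2 \<le> Gamma (x - 1/2) * Gamma (x + 1/2)" using pos by simp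
  moreover have "Gamma (x + 1/2) = (x - 1/2) * Gamma (x - 1/2)"
    using Gamma_plus1[of "x - 1/2"] x by (simp add: nonpos_Ints_def algebra_simps)
  ultimately have "(x - 1/2) * (Gamma x)\<^sup>2 \<le> (Gamma (x + 1/2))\<^sup>2"
    using x mult_left_mono[of "(Gamma x)\<^sup>2" "Gamma (x - 1/2) * Gamma (x + 1/2)" "x - 1/2"]
    by (simp add: power2_eq_square mult_ac)
  then have "sqrt (x - 1/2) * Gamma x \<le> Gamma (x + 1/2)"
    using pos x power2_le_imp_le[of "sqrt (x - 1/2) * Gamma x" "Gamma (x + 1/2)"]
    by (simp add: power_mult_distrib)
  then have G: "sqrt (real d / 2) * Gamma ((real d + 1) / 2) \<le> Gamma (real d / 2 + 1)"
    by (simp add: x_def add_divide_distrib add.commute)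
  have e1: "real (d - 1) / 2 + 1 = (real d + 1) / 2" "real (d - 1) / 2 = real d / 2 - 1 / 2"
    using assms by (simp_all add: field_simps)
  have pw: "pi powr (real d / 2) = pi powr (real (d - 1) / 2) * sqrt pi"
    unfolding e1(2) by (simp add: powr_half_sqrt[symmetric] powr_add[symmetric])
  have Gp: "Gamma ((real d + 1) / 2) > 0" "Gamma (real d / 2 + 1) > 0" by auto
  have "sqrt (real d / (2 * pi)) * unit_ball_vol (real d)
     = pi powr (real (d - 1) / 2) * (sqrt (real d / 2) / Gamma (real d / 2 + 1))"
    unfolding unit_ball_vol_def pw by (simp add: real_sqrt_divide real_sqrt_mult)
  also have "\<dots> \<le> pi powr (real (d - 1) / 2) * (1 / Gamma ((real d + 1) / 2))"
    using G Gp by (intro mult_left_mono) (simp_all add: field_simps)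
  also have "\<dots> = unit_ball_vol (real (d - 1))"
    unfolding unit_ball_vol_def e1(1) by simp
  finally show ?thesis .
qed

text \<open>The dual of \<open>zone\<close>: for a unit vector \<open>x\<close>, these are the poles
  \<open>g\<close> with \<open>x\<close> in \<open>zone s g\<close>.\<close>

definition slab :: "real \<Rightarrow> 'a::euclidean_space \<Rightarrow> 'a set" where
  "slab s x = {g. \<bar>x \<bullet> g\<bar> \<le> s * norm g}"

lemma closed_slab: "closed (slab s x)"
  unfolding slab_def by (intro closed_Collect_le continuous_intros)

lemma sets_slab [measurable, simp]: "slab s x \<in> sets borel"
  using closed_slab by (rule borel_closed)

text \<open>Fubini for a product of an interval and an annulus. In coordinate functions the
  hyperplane orthogonal to \<open>b\<close> is simply the product over \<open>A\<close>, where the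
  volume of balls is known.\<close>

lemma emeasure_PiM_slab_annulus:
  fixes A :: "'i set"
  assumes A: "finite A" "b \<notin> A" and h: "0 \<le> h" and r: "0 < r" "r \<le> R"
  shows "emeasure (Pi\<^sub>M (insert b A) (\<lambda>_. lborel))
     ({f. \<bar>f b\<bar> \<le> h \<and> r < sqrt (\<Sum>i\<in>A. (f i)\<^sup>2) \<and> sqrt (\<Sum>i\<in>A. (f i)\<^sup>2) \<le> R} \<inter>
       space (Pi\<^sub>M (insert b A) (\<lambda>_. lborel))) =
     ennreal (2 * h * (unit_ball_vol (real (card A)) * (R ^ card A - r ^ card A)))"
    (is "emeasure ?M ?E = _")
proof -
  interpret product_sigma_finite "\<lambda>_. lborel" by standard
  have R: "0 < R" using r by simp
  let ?N = "Pi\<^sub>M A (\<lambda>_. lborel :: real measure)"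
  let ?n = "\<lambda>f. sqrt (\<Sum>i\<in>A. (f i)\<^sup>2)"
  let ?B = "\<lambda>r. {f. ?n f \<le> r} \<inter> space ?N"
  let ?W = "?B R - ?B r"
  have B: "?B r \<in> sets ?N" for r by measurable
  have E: "?E \<in> sets ?M"
    using A by measurable
  have "emeasure ?M ?E = (\<integral>\<^sup>+f. indicator ?E f \<partial>?M)"
    using E by simp
  also have "\<dots> = (\<integral>\<^sup>+y. \<integral>\<^sup>+x. indicator ?E (x(b := y)) \<partial>?N \<partial>lborel)"
    using A E by (subst product_nn_integral_insert_rev) auto
  also have "\<dots> = (\<integral>\<^sup>+y. \<integral>\<^sup>+x. indicator {-h..h} y * indicator ?W x \<partial>?N \<partial>lborel)"
  proof (intro nn_integral_cong)
    fix y f assume f: "f \<in> space ?N"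
    have "(\<Sum>x\<in>A. (if x = b then y else f x)\<^sup>2) = (\<Sum>x\<in>A. (f x)\<^sup>2)"
      using A by (intro sum.cong) auto
    then show "indicator ?E (f(b := y)) = (indicator {-h..h} y * indicator ?W f :: ennreal)"
      using f by (auto simp: indicator_def space_PiM PiE_def)
  qed
  also have "\<dots> = (\<integral>\<^sup>+y. indicator {-h..h} y * emeasure ?N ?W \<partial>lborel)"
    using B by (intro nn_integral_cong) (subst nn_integral_cmult, auto)
  also have "\<dots> = emeasure lborel {-h..h} * emeasure ?N ?W"
    by (subst nn_integral_multc) auto
  also have "emeasure lborel {-h..h} = ennreal (2 * h)" using h by simp
  also have "emeasure ?N ?W = emeasure ?N (?B R) - emeasure ?N (?B r)"
    using B r emeasure_cball_aux[OF A(1) r(1)] by (intro emeasure_Diff) auto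
  also have "\<dots> = ennreal (unit_ball_vol (real (card A)) * R ^ card A - unit_ball_vol (real (card A)) * r ^ card A)"
    unfolding emeasure_cball_aux[OF A(1) r(1)] emeasure_cball_aux[OF A(1) R]
    using r by (intro ennreal_minus) simp
  also have "ennreal (2 * h) * \<dots> = ennreal (2 * h * (unit_ball_vol (real (card A)) * (R ^ card A - r ^ card A)))"
    using h by (subst ennreal_mult'[symmetric]) (auto simp: right_diff_distrib)
  finally show ?thesis .
qed

text \<open>
  The slab contains the product of the interval \<open>[- s/2, s/2]\<close> with the annulus of radii \<open>1/2\<close> and
  \<open>sqrt (1 - s\<^sup>2/4)\<close> in the hyperplane orthogonal to \<open>b\<close>.
\<close>

lemma measure_slab_Basis_ge:
  fixes b :: "'a::euclidean_space"
  assumes b: "b \<in> Basis" and s: "0 \<le> s" "s \<le> 1"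
  shows "s * unit_ball_vol (real (DIM('a) - 1)) * (sqrt (1 - s\<^sup>2 / 4) ^ (DIM('a) - 1) - (1 / 2) ^ (DIM('a) - 1))
     \<le> measure lborel (cball 0 1 \<inter> slab s b)"
proof -
  define A where "A = Basis - {b}"
  define R where "R = sqrt (1 - s\<^sup>2 / 4)"
  have A: "finite A" "b \<notin> A" "insert b A = Basis" "card A = DIM('a) - 1"
    using b by (auto simp: A_def)
  have s2: "s\<^sup>2 \<le> 1" using s by (simp add: abs_square_le_1)
  have R: "1/2 \<le> R" unfolding R_def using s2
    by (intro real_le_rsqrt) (simp add: power2_eq_square)
  let ?M = "Pi\<^sub>M Basis (\<lambda>_. lborel :: real measure)"
  let ?\<psi> = "\<lambda>f. (\<Sum>b\<in>Basis. f b *\<^sub>R b) :: 'a"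
  let ?E = "{f. \<bar>f b\<bar> \<le> s / 2 \<and> 1/2 < sqrt (\<Sum>i\<in>A. (f i)\<^sup>2) \<and> sqrt (\<Sum>i\<in>A. (f i)\<^sup>2) \<le> R} \<inter> space ?M"
  let ?S = "cball 0 1 \<inter> slab s b"
  have sub: "?E \<subseteq> ?\<psi> -` ?S \<inter> space ?M"
  proof
    fix f assume f: "f \<in> ?E"
    let ?q = "\<Sum>i\<in>A. (f i)\<^sup>2"
    have q0: "?q \<ge> 0" by (simp add: sum_nonneg)
    have bf: "b \<bullet> ?\<psi> f = f b" using b by (subst inner_commute) simp
    have "norm (?\<psi> f) = sqrt (\<Sum>i\<in>Basis. (f i)\<^sup>2)"
      by (simp add: norm_eq_sqrt_inner euclidean_inner[of "?\<psi> f" "?\<psi> f"] power2_eq_square)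
    also have "(\<Sum>i\<in>Basis. (f i)\<^sup>2) = (f b)\<^sup>2 + ?q"
      unfolding A(3)[symmetric] using A(1,2) by simp
    finally have n: "norm (?\<psi> f) = sqrt ((f b)\<^sup>2 + ?q)" .
    have "?q = (sqrt ?q)\<^sup>2" using q0 by simp
    also have "\<dots> \<le> R\<^sup>2" using f q0 by (intro power_mono) auto
    also have "\<dots> = 1 - s\<^sup>2 / 4" using s2 by (simp add: R_def)
    finally have qR: "?q \<le> 1 - s\<^sup>2 / 4" .
    have fb: "\<bar>f b\<bar> \<le> s / 2" using f by auto
    then have "(f b)\<^sup>2 \<le> (s/2)\<^sup>2" using s by (simp add: abs_le_square_iff[symmetric])
    with qR have "(f b)\<^sup>2 + ?q \<le> 1" by (simp add: power_divide)
    then have 1: "norm (?\<psi> f) \<le> 1" unfolding n by simp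
    \<comment> \<open>The inner radius 1/2 is used here: it turns the fixed height
      \<open>s / 2\<close> into the homogeneous bound \<open>s * norm\<close> of the slab.\<close>
    have "1/2 < sqrt ?q" using f by auto
    also have "\<dots> \<le> norm (?\<psi> f)" unfolding n by simp
    finally have "s * (1/2) \<le> s * norm (?\<psi> f)" using s by (intro mult_left_mono) auto
    then have "\<bar>b \<bullet> ?\<psi> f\<bar> \<le> s * norm (?\<psi> f)" unfolding bf using fb by simp
    then show "f \<in> ?\<psi> -` ?S \<inter> space ?M" using 1 f by (auto simp: slab_def)
  qed
  have "ennreal (s * unit_ball_vol (real (DIM('a) - 1)) * (R ^ (DIM('a) - 1) - (1 / 2) ^ (DIM('a) - 1)))
     = emeasure ?M ?E"
    using emeasure_PiM_slab_annulus[OF A(1,2), of "s/2" "1/2" R] s R unfolding A(3,4)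
    by (simp add: mult_ac)
  also have "\<dots> \<le> emeasure ?M (?\<psi> -` ?S \<inter> space ?M)"
    by (intro emeasure_mono sub) measurable
  also have "\<dots> = emeasure lborel ?S"
    by (subst lborel_eq) (subst emeasure_distr, auto)
  also have "\<dots> = ennreal (measure lborel ?S)"
    by (intro emeasure_eq_ennreal_measure) 
      (metis bounded_cball bounded_Int emeasure_bounded_finite infinity_ennreal_def less_irrefl)
  finally show ?thesis by (simp add: R_def)
qed

text \<open>Enclosure in a box of side \<open>2 * s\<close> along \<open>b\<close> and 2 in the
  other directions. The crude factor affects only the constant in the multiplicity bound.\<close>

lemma measure_slab_Basis_le:
  fixes b :: "'a::euclidean_space"
  assumes b: "b \<in> Basis" and s: "0 \<le> s"
  shows "measure lborel (cball 0 1 \<inter> slab s b) \<le> s * 2 ^ DIM('a)"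
proof -
  let ?u = "\<Sum>i\<in>Basis. (if i = b then s else 1) *\<^sub>R i :: 'a"
  have sub: "cball 0 1 \<inter> slab s b \<subseteq> cbox (- ?u) ?u"
  proof
    fix g assume g: "g \<in> cball 0 1 \<inter> slab s b"
    then have n: "norm g \<le> 1" and "\<bar>b \<bullet> g\<bar> \<le> s * norm g" by (auto simp: slab_def)
    then have "\<bar>g \<bullet> b\<bar> \<le> s" using s mult_left_mono[OF n s] by (simp add: inner_commute)
    moreover have "\<bar>g \<bullet> i\<bar> \<le> 1" if "i \<in> Basis" for i
      using Basis_le_norm[OF that, of g] n by simp
    ultimately show "g \<in> cbox (- ?u) ?u"
      by (auto simp: mem_box abs_le_iff)
  qed
  have "measure lborel (cball 0 1 \<inter> slab s b) \<le> measure lborel (cbox (- ?u) ?u)"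
    using sub by (intro measure_mono_fmeasurable) auto
  also have "\<dots> = (\<Prod>i\<in>Basis. 2 * (if i = b then s else 1))"
    using s by (subst content_cbox) (auto simp: intro!: prod.cong)
  also have "\<dots> = 2 ^ DIM('a) * s"
    using b by (simp add: prod.distrib)
  finally show ?thesis by (simp add: mult.commute)
qed

text \<open>
  \<^const>\<open>lborel\<close> and its image under the orthogonal map are both translation invariant and agree on the
  unit ball; evaluating the double integral of \<open>indicator S (f x) * indicator ?B (f x - y)\<close> in both
  orders shows that they agree everywhere. (\<open>measure_orthogonal_image\<close> would need a wellordered index type.)
\<close>

lemma emeasure_orthogonal_vimage:
  fixes f :: "'a::euclidean_space \<Rightarrow> 'a"
  assumes f: "orthogonal_transformation f" and S: "S \<in> sets borel"
  shows "emeasure lborel (f -` S) = emeasure lborel S"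
proof -
  let ?B = "cball (0::'a) 1"
  let ?V = "emeasure lborel ?B"
  have lin: "linear f" using f by (rule orthogonal_transformation_linear)
  have [measurable]: "f \<in> borel_measurable borel"
    using lin by (intro borel_measurable_continuous_onI linear_continuous_on linear_conv_bounded_linear[THEN iffD1])
  have [measurable]: "?B \<in> sets borel" by simp
  note [measurable] = S
  have V: "?V \<noteq> 0" "?V \<noteq> \<infinity>" 
    using unit_ball_vol_pos[of "real DIM('a)"] by (simp_all add: emeasure_cball less_imp_neq[symmetric])
  have tr: "(\<integral>\<^sup>+x. g (c + x) \<partial>lborel) = (\<integral>\<^sup>+x. g x \<partial>lborel)" if [measurable]: "g \<in> borel_measurable borel"
    for g :: "'a \<Rightarrow> ennreal" and c
    by (subst (2) lborel_distr_plus[of c, symmetric]) (subst nn_integral_distr, auto)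
  have "emeasure lborel (f -` S) * ?V = (\<integral>\<^sup>+x. indicator (f -` S) x * ?V \<partial>lborel)"
    by (subst nn_integral_multc) (auto simp: measurable_sets_borel[of f borel])
  also have "\<dots> = (\<integral>\<^sup>+x. \<integral>\<^sup>+y. indicator S (f x) * indicator ?B (f x - y) \<partial>lborel \<partial>lborel)"
  proof (intro nn_integral_cong)
    fix x
    have "(\<integral>\<^sup>+y. indicator S (f x) * indicator ?B (f x - y) \<partial>lborel)
        = indicator S (f x) * (\<integral>\<^sup>+y. indicator (cball (f x) 1) y \<partial>lborel)"
      by (subst nn_integral_cmult[symmetric])
        (auto simp: dist_norm norm_minus_commute indicator_def intro!: nn_integral_cong borel_measurable_indicator)
    also have "\<dots> = indicator (f -` S) x * ?V"
      by (subst nn_integral_indicator) (auto simp: emeasure_cball indicator_def)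
    finally show "indicator (f -` S) x * ?V = (\<integral>\<^sup>+y. indicator S (f x) * indicator ?B (f x - y) \<partial>lborel)"
      by simp
  qed
  also have "\<dots> = (\<integral>\<^sup>+y. \<integral>\<^sup>+x. indicator S (f x) * indicator ?B (f x - y) \<partial>lborel \<partial>lborel)"
    by (rule lborel_pair.Fubini') measurable
  also have "\<dots> = (\<integral>\<^sup>+y. \<integral>\<^sup>+x. indicator S (y + f x) * indicator ?B (f x) \<partial>lborel \<partial>lborel)"
  proof (rule nn_integral_cong)
    fix y
    \<comment> \<open>Translating the integration variable by \<open>z\<close> turns
      \<open>f x - y\<close> into \<open>f x\<close> and \<open>f x\<close> into
      \<open>y + f x\<close>.\<close>
    obtain z where z: "y = f z" using orthogonal_transformation_surj[OF f] by (metis surjD)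
    show "(\<integral>\<^sup>+x. indicator S (f x) * indicator ?B (f x - y) \<partial>lborel)
      = (\<integral>\<^sup>+x. indicator S (y + f x) * indicator ?B (f x) \<partial>lborel)"
      by (subst tr[of _ z, symmetric]) (auto simp: z linear_add[OF lin])
  qed
  also have "\<dots> = (\<integral>\<^sup>+x. \<integral>\<^sup>+y. indicator S (y + f x) * indicator ?B (f x) \<partial>lborel \<partial>lborel)"
    by (rule lborel_pair.Fubini') measurable
  also have "\<dots> = (\<integral>\<^sup>+x. emeasure lborel S * indicator ?B x \<partial>lborel)"
  proof (intro nn_integral_cong)
    fix x
    have "(\<integral>\<^sup>+y. indicator S (y + f x) \<partial>lborel) = emeasure lborel S"
      using tr[of "indicator S" "f x"] by (simp add: add.commute)
    moreover have "norm (f x) = norm x" using f by (rule orthogonal_transformation_norm)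
    ultimately show "(\<integral>\<^sup>+y. indicator S (y + f x) * indicator ?B (f x) \<partial>lborel) = emeasure lborel S * indicator ?B x"
      by (subst nn_integral_multc) (auto simp: indicator_def)
  qed
  also have "\<dots> = emeasure lborel S * ?V" by (subst nn_integral_cmult) auto
  finally show ?thesis using V by (metis mult_divide_eq_ennreal infinity_ennreal_def)
qed

lemma measure_slab_rotate:
  fixes x y :: "real ^ 'd"
  assumes "norm x = 1" "norm y = 1"
  shows "measure lborel (cball 0 1 \<inter> slab s x) = measure lborel (cball 0 1 \<inter> slab s y)"
proof -
  obtain f where f: "orthogonal_transformation f" "f x = y"
    using orthogonal_transformation_exists_1[OF assms] by blast
  have "y \<bullet> f h = x \<bullet> h" for h using f unfolding orthogonal_transformation_def by metis
  then have "f -` (cball 0 1 \<inter> slab s y) = cball 0 1 \<inter> slab s x"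
    using f(1) by (auto simp: slab_def orthogonal_transformation_norm)
  then show ?thesis
    using emeasure_orthogonal_vimage[OF f(1), of "cball 0 1 \<inter> slab s y"] by (simp add: measure_def)
qed

section \<open>Nets on the sphere\<close>

text \<open>A mean value bound; it shows that the volume of a shell is at most proportional to its
  width.\<close>

lemma power_Suc_diff_le:
  fixes x y :: real
  assumes "0 \<le> y" "y \<le> x"
  shows "x ^ Suc n - y ^ Suc n \<le> real (Suc n) * (x - y) * x ^ n"
proof (induction n)
  case (Suc n)
  have "x ^ Suc (Suc n) - y ^ Suc (Suc n) = x * (x ^ Suc n - y ^ Suc n) + (x - y) * y ^ Suc n"
    by (simp add: algebra_simps)
  also have "\<dots> \<le> x * (real (Suc n) * (x - y) * x ^ n) + (x - y) * x ^ Suc n"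
    using assms Suc by (intro add_mono mult_left_mono power_mono) auto
  also have "\<dots> = real (Suc (Suc n)) * (x - y) * x ^ Suc n"
    by (simp add: algebra_simps)
  finally show ?case .
qed simp

text \<open>
  Packing inside the spherical shell of width \<open>\<delta>\<close>, rather than inside a ball, gives the exponent
  \<open>d - 1\<close>; the lossy lower bound of \<open>measure_slab_ge\<close> would not beat the exponent \<open>d\<close>.
\<close>

lemma card_separated_sphere_le:
  fixes N :: "'a::euclidean_space set"
  assumes fin: "finite N" and N: "N \<subseteq> sphere 0 1" and \<delta>: "0 < \<delta>" "\<delta> \<le> 1"
    and sep: "\<And>x y. x \<in> N \<Longrightarrow> y \<in> N \<Longrightarrow> x \<noteq> y \<Longrightarrow> \<delta> \<le> dist x y"
  shows "real (card N) * \<delta> ^ (DIM('a) - 1) \<le> real DIM('a) * 4 ^ DIM('a)"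
proof -
  obtain m where m: "DIM('a) = Suc m" using DIM_positive[where 'a='a] gr0_conv_Suc by blast
  define v where "v = unit_ball_vol (real DIM('a))"
  have v: "v > 0" by (simp add: v_def)
  let ?U = "\<Union>x\<in>N. ball x (\<delta>/2)"
  let ?S = "cball (0::'a) (1 + \<delta>/2) - ball 0 (1 - \<delta>/2)"
  have disj: "disjoint_family_on (\<lambda>x. ball x (\<delta>/2)) N"
    unfolding disjoint_family_on_def
  proof (intro ballI impI)
    fix x y assume "x \<in> N" "y \<in> N" "x \<noteq> y"
    then show "ball x (\<delta>/2) \<inter> ball y (\<delta>/2) = {}"
      using sep[of x y] by (simp add: disjoint_ballI)
  qed
  have sub: "?U \<subseteq> ?S"
  proof
    fix z assume "z \<in> ?U"
    then obtain x where x: "x \<in> N" "dist x z < \<delta>/2" by auto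
    then have "norm x = 1" using N by auto
    then have "\<bar>norm z - 1\<bar> < \<delta>/2"
      using x(2) norm_triangle_ineq3[of z x] by (simp add: dist_norm norm_minus_commute)
    then have "norm z \<le> 1 + \<delta>/2" "1 - \<delta>/2 \<le> norm z" by linarith+
    then show "z \<in> ?S" by simp
  qed
  have "real (card N) * (v * (\<delta>/2) ^ DIM('a)) = (\<Sum>x\<in>N. measure lborel (ball x (\<delta>/2)))"
    using \<delta> by (simp add: content_ball v_def)
  also have "\<dots> = measure lborel ?U"
    using fin disj \<delta> by (intro measure_finite_Union[symmetric]) (auto simp: emeasure_ball)
  also have "\<dots> \<le> measure lborel ?S"
    using sub fin by (intro measure_mono_fmeasurable) (auto intro!: fmeasurable_Diff fmeasurable_compact[OF compact_cball])
  also have "\<dots> = measure lborel (cball (0::'a) (1 + \<delta>/2)) - measure lborel (ball (0::'a) (1 - \<delta>/2))"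
    using \<delta> by (intro measure_Diff) (auto simp: emeasure_cball)
  also have "\<dots> = v * ((1 + \<delta>/2) ^ Suc m - (1 - \<delta>/2) ^ Suc m)"
    using \<delta> by (simp add: content_ball content_cball m v_def right_diff_distrib)
  also have "\<dots> \<le> v * (real (Suc m) * ((1 + \<delta>/2) - (1 - \<delta>/2)) * (1 + \<delta>/2) ^ m)"
    using \<delta> v by (intro mult_left_mono power_Suc_diff_le) auto
  also have "\<dots> \<le> v * (real (Suc m) * \<delta> * 2 ^ m)"
    using \<delta> v by (intro mult_left_mono mult_mono power_mono) auto
  finally have "v * (real (card N) * (\<delta>/2) ^ Suc m) \<le> v * (real (Suc m) * \<delta> * 2 ^ m)"
    by (simp only: m mult_ac)
  then have "real (card N) * (\<delta>/2) ^ Suc m \<le> real (Suc m) * \<delta> * 2 ^ m"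
    using v by (simp only: mult_le_cancel_left_pos)
  then have "\<delta> * (real (card N) * \<delta> ^ m) \<le> \<delta> * (real (Suc m) * 2 ^ m * 2 ^ Suc m)"
    by (simp add: power_divide field_simps)
  then have "real (card N) * \<delta> ^ m \<le> real (Suc m) * 2 ^ m * 2 ^ Suc m"
    using \<delta> by simp
  also have "\<dots> \<le> real (Suc m) * (2 ^ Suc m * 2 ^ Suc m)" by simp
  also have "(2::real) ^ Suc m * 2 ^ Suc m = 4 ^ Suc m"
    by (simp flip: power_mult_distrib)
  finally show ?thesis by (simp add: m)
qed

text \<open>A separated set of largest cardinality is a net, since a point far from all its members
  could be added. The packing bound makes the maximum exist and bounds the size.\<close>

lemma exists_sphere_net:
  assumes \<delta>: "0 < \<delta>" "\<delta> \<le> 1"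
  shows "\<exists>N :: 'a::euclidean_space set. finite N \<and> N \<subseteq> sphere 0 1 \<and>
    (\<forall>x\<in>sphere 0 1. \<exists>y\<in>N. dist x y \<le> \<delta>) \<and>
    real (card N) * \<delta> ^ (DIM('a) - 1) \<le> real DIM('a) * 4 ^ DIM('a)"
proof -
  define Q where "Q N \<longleftrightarrow> finite N \<and> N \<subseteq> sphere 0 1 \<and> (\<forall>x\<in>N. \<forall>y\<in>N. x \<noteq> y \<longrightarrow> \<delta> \<le> dist x y)"
    for N :: "'a set"
  define B where "B = real DIM('a) * 4 ^ DIM('a)"
  have Q: "real (card N) * \<delta> ^ (DIM('a) - 1) \<le> B" if "Q N" for N
    using that card_separated_sphere_le[OF _ _ \<delta>, of N] unfolding Q_def B_def by auto
  have bound: "card N < nat \<lceil>B / \<delta> ^ (DIM('a) - 1)\<rceil> + 1" if "Q N" for N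
  proof -
    have "real (card N) \<le> B / \<delta> ^ (DIM('a) - 1)" using Q[OF that] \<delta> by (simp add: field_simps)
    then show ?thesis by linarith
  qed
  have "Q {}" by (simp add: Q_def)
  then obtain N where N: "Q N" "\<And>N'. Q N' \<Longrightarrow> card N' \<le> card N"
    using ex_has_greatest_nat[of Q "{}" card] bound by metis
  have "\<exists>y\<in>N. dist x y \<le> \<delta>" if x: "x \<in> sphere 0 1" for x
  proof (rule ccontr)
    assume no: "\<not> ?thesis"
    then have "x \<notin> N" using \<delta> by force
    have "Q (insert x N)"
      using N(1) x no unfolding Q_def by (auto simp: dist_commute)
    then show False using N(2)[of "insert x N"] \<open>x \<notin> N\<close> N(1) by (simp add: Q_def)
  qed
  then show ?thesis using N(1) Q[OF N(1)] unfolding Q_def B_def by (intro exI[of _ N]) auto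
qed

section \<open>The random zone family, for abstract parameters\<close>

lemma prod_list_exp_indicator:
  "prod_list (map (\<lambda>u. if u \<in> S then exp 1 else 1) us) = exp (real (length (filter (\<lambda>u. u \<in> S) us)))"
  by (induction us) (simp_all add: exp_add mult.commute)

lemma distinct_map_sorted_wrt:
  assumes "sorted_wrt (\<lambda>u v. f u \<noteq> f v) us"
  shows "distinct (map f us)"
  using assms by (induction us) auto

text \<open>A union bound over the net: \<open>p\<close> and \<open>q\<close> bound the
  probabilities that a random pole falls in the narrower and in the wider slab of a net point, and
  \<open>small\<close> keeps the total weight of all failures below 1. The margins
  \<open>\<delta>\<close> in the slabs carry the conclusion from the net to the sphere.\<close>

lemma exists_zone_family:
  fixes N :: "(real ^ 'd) set"
  assumes dim: "2 \<le> CARD('d)" and fin: "finite N" and N: "N \<subseteq> sphere 0 1"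
    and net: "\<And>x. x \<in> sphere 0 1 \<Longrightarrow> \<exists>y\<in>N. dist x y \<le> \<delta>"
    and r: "0 < r" "r < 1"
    and p: "\<And>x. x \<in> N \<Longrightarrow>
      p * unit_ball_vol (real CARD('d)) \<le> measure lborel (cball 0 1 \<inter> slab (r - \<delta>) x)"
    and q: "\<And>x. x \<in> N \<Longrightarrow>
      measure lborel (cball 0 1 \<inter> slab (r + \<delta>) x) \<le> q * unit_ball_vol (real CARD('d))"
    and small: "real (card N) * ((1 - p) ^ n + exp (- a) * (1 + (exp 1 - 1) * q) ^ n) < 1"
  shows "\<exists>F. finite F \<and> card F = n \<and> (\<forall>Z\<in>F. \<exists>u::real ^ 'd. u \<noteq> 0 \<and> Z = zone r u) \<and>
    \<Union>F = sphere 0 1 \<and> (\<forall>x\<in>sphere 0 1. real (card {Z\<in>F. x \<in> Z}) \<le> a)"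
proof -
  let ?B = "cball (0 :: real ^ 'd) 1"
  define V where "V = unit_ball_vol (real CARD('d))"
  have V: "V > 0" by (simp add: V_def)
  \<comment> \<open>Only the directions of the poles matter, so the uniform law on the ball serves,
    and probabilities of slabs become volumes.\<close>
  define M where "M = uniform_measure lborel ?B"
  have emB: "emeasure lborel ?B = ennreal V" by (simp add: emeasure_cball V_def)
  interpret M: prob_space M
    unfolding M_def by (rule prob_space_uniform_measure) (use emB V in auto)
  have setsM [measurable_cong, simp]: "sets M = sets borel" "space M = UNIV"
    by (simp_all add: M_def)
  have prob: "M.prob S = measure lborel (?B \<inter> S) / V" if "S \<in> sets borel" for S
    unfolding M_def using that emB V
    by (subst measure_uniform_measure) (auto simp: measure_def)
  have AE_M: "AE u in M. u \<notin> S" if "negligible S" for S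
  proof -
    have "AE u in lebesgue. u \<notin> S" using that by (simp add: negligible_iff_null_sets AE_not_in)
    then have "AE u in lborel. u \<notin> S" by (simp add: AE_completion_iff)
    then show ?thesis unfolding M_def by (intro AE_uniform_measureI) auto
  qed
  \<comment> \<open>Two tests per net point. For \<open>True\<close> the product over the poles is 1
    if all of them miss the narrower slab; for \<open>False\<close> it is \<open>exp\<close> of the
    number of poles in the wider slab.\<close>
  define \<phi> where "\<phi> = (\<lambda>(x :: real ^ 'd, b) u. if b then indicator (- slab (r - \<delta>) x) u
     else if u \<in> slab (r + \<delta>) x then exp 1 else (1::real))"
  define c where "c = (\<lambda>(x :: real ^ 'd, b). if b then 1 - p else 1 + (exp 1 - 1) * q)"
  \<comment> \<open>With the weight \<open>exp (- a)\<close> the second test reaches 1 as soon as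
    \<open>a\<close> poles lie in the wider slab.\<close>
  define w where "w = (\<lambda>(x :: real ^ 'd, b). if b then 1 else exp (- a))"
  have \<phi>F: "\<phi> (x, False) = (\<lambda>u. 1 + (exp 1 - 1) * indicator (slab (r + \<delta>) x) u)" for x
    by (auto simp: \<phi>_def fun_eq_iff)
  have \<phi>T: "\<phi> (x, True) = (indicator (- slab (r - \<delta>) x))" for x
    by (auto simp: \<phi>_def fun_eq_iff)
  have slab: "slab s x \<in> M.events" "- slab s x \<in> M.events" for s x by auto
  have ind: "integrable M (indicat_real S)" if "S \<in> sets borel" for S
    using that by (intro integrable_real_indicator) (auto simp: less_top[symmetric])
  have int: "integrable M (\<phi> j)" for j
    by (cases j; cases "snd j") (auto simp: \<phi>F \<phi>T intro!: ind Bochner_Integration.integrable_add)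
  have e: "M.expectation (\<phi> j) \<le> c j" if jN: "j \<in> N \<times> UNIV" for j
  proof -
    obtain x b where j: "j = (x, b)" "x \<in> N" using jN by blast
    show ?thesis
    proof (cases b)
      case True
      have "M.expectation (\<phi> j) = M.prob (space M - slab (r - \<delta>) x)"
        using True j by (simp add: \<phi>T slab Compl_eq_Diff_UNIV)
      also have "\<dots> = 1 - M.prob (slab (r - \<delta>) x)" by (intro M.prob_compl) simp
      also have "\<dots> \<le> 1 - p" using p[OF j(2)] V by (simp add: prob V_def[symmetric] field_simps)
      finally show ?thesis using j True by (simp add: c_def)
    next
      case False
      have "M.expectation (\<phi> j) = 1 + (exp 1 - 1) * M.prob (slab (r + \<delta>) x)"
        using False j by (simp add: \<phi>F ind Bochner_Integration.integral_add M.prob_space[simplified])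
      also have "\<dots> \<le> 1 + (exp 1 - 1) * q"
        using q[OF j(2)] V by (intro add_left_mono mult_left_mono) (auto simp: prob V_def[symmetric] field_simps)
      finally show ?thesis using j False by (simp add: c_def)
    qed
  qed
  have "AE u in M. u \<noteq> 0" using AE_M[of "{0}"] by simp
  moreover have "AE u in M. u \<notin> span {v}" for v
  proof (rule AE_M)
    have "dim (span {v}) \<le> 1" using dim_le_card[of "span {v}" "{v}"] by simp
    then show "negligible (span {v})" using dim by (intro negligible_lowdim) simp
  qed
  ultimately obtain us where us: "length us = n" "\<forall>u\<in>set us. u \<noteq> 0" "sorted_wrt (\<lambda>u v. u \<notin> span {v}) us"
    "(\<Sum>j\<in>N\<times>UNIV. w j * prod_list (map (\<phi> j) us)) \<le> (\<Sum>j\<in>N\<times>UNIV. w j * c j ^ n)"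
    using M.exists_list_sum_prod_le[of "N \<times> UNIV" \<phi> c "\<lambda>u. u \<noteq> 0" "\<lambda>u v. u \<notin> span {v}" w n] fin int e
    by (force simp: \<phi>_def w_def)
  have "(\<Sum>j\<in>N\<times>UNIV. w j * c j ^ n) = (\<Sum>x\<in>N. \<Sum>b\<in>UNIV. w (x, b) * c (x, b) ^ n)"
    by (simp add: sum.cartesian_product)
  also have "\<dots> = real (card N) * ((1 - p) ^ n + exp (- a) * (1 + (exp 1 - 1) * q) ^ n)"
    by (simp add: UNIV_bool w_def c_def algebra_simps)
  finally have lt1: "(\<Sum>j\<in>N\<times>UNIV. w j * prod_list (map (\<phi> j) us)) < 1" using us(4) small by simp
  \<comment> \<open>The terms are nonnegative, so each is below 1, which excludes every failure at
    every net point.\<close>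
  have lt1_each: "w j * prod_list (map (\<phi> j) us) < 1" if "j \<in> N \<times> UNIV" for j
  proof (rule le_less_trans[OF _ lt1], rule member_le_sum[OF that])
    show "0 \<le> w i * prod_list (map (\<phi> i) us)" for i
      by (intro mult_nonneg_nonneg prod_list_nonneg) (auto simp: w_def \<phi>_def split: prod.splits)
  qed (use fin in auto)
  have hit: "\<exists>u\<in>set us. u \<in> slab (r - \<delta>) x" if "x \<in> N" for x
  proof (rule ccontr)
    assume "\<not> ?thesis"
    then have "map (\<phi> (x, True)) us = map (\<lambda>_. 1) us" by (auto simp: \<phi>T)
    with lt1_each[of "(x, True)"] that show False by (simp add: w_def map_replicate_const)
  qed
  have few: "real (length (filter (\<lambda>u. u \<in> slab (r + \<delta>) x) us)) < a" if "x \<in> N" for x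
  proof -
    have "exp (- a) * exp (real (length (filter (\<lambda>u. u \<in> slab (r + \<delta>) x) us))) < 1"
      using lt1_each[of "(x, False)"] that by (simp add: w_def \<phi>_def prod_list_exp_indicator)
    then show ?thesis by (simp flip: exp_add)
  qed
  have near: "\<bar>x \<bullet> u\<bar> \<le> \<bar>y \<bullet> u\<bar> + \<delta> * norm u" if "dist x y \<le> \<delta>" for x y u :: "real ^ 'd"
  proof -
    have "\<bar>(x - y) \<bullet> u\<bar> \<le> norm (x - y) * norm u" by (rule Cauchy_Schwarz_ineq2)
    also have "\<dots> \<le> \<delta> * norm u" using that by (intro mult_right_mono) (auto simp: dist_norm)
    finally show ?thesis by (simp add: inner_diff_left)
  qed
  define zs where "zs = map (zone r) us"
  have "sorted_wrt (\<lambda>u v. zone r u \<noteq> zone r v) us"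
    by (rule sorted_wrt_mono_rel[OF _ us(3)]) (use zone_eq_imp_parallel[OF _ r] us(2) in blast)
  then have dist: "distinct zs" unfolding zs_def by (rule distinct_map_sorted_wrt)
  show ?thesis
  proof (intro exI[of _ "set zs"] conjI)
    show "card (set zs) = n" using distinct_card[OF dist] us(1) by (simp add: zs_def)
    show "\<forall>Z\<in>set zs. \<exists>u. u \<noteq> 0 \<and> Z = zone r u" using us(2) by (auto simp: zs_def)
    show "\<Union>(set zs) = sphere 0 1"
    proof
      show "\<Union>(set zs) \<subseteq> sphere 0 1" by (auto simp: zs_def zone_def)
      show "sphere 0 1 \<subseteq> \<Union>(set zs)"
      proof
        fix x :: "real ^ 'd" assume x: "x \<in> sphere 0 1"
        then obtain y where y: "y \<in> N" "dist x y \<le> \<delta>" using net by blast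
        then obtain u where u: "u \<in> set us" "u \<in> slab (r - \<delta>) y" using hit by blast
        then have "\<bar>x \<bullet> u\<bar> \<le> r * norm u"
          using near[OF y(2), of u] by (simp add: slab_def algebra_simps)
        then show "x \<in> \<Union>(set zs)" using x u(1) by (auto simp: zs_def zone_def)
      qed
    qed
    show "\<forall>x\<in>sphere 0 1. real (card {Z \<in> set zs. x \<in> Z}) \<le> a"
    proof
      fix x :: "real ^ 'd" assume x: "x \<in> sphere 0 1"
      then obtain y where y: "y \<in> N" "dist x y \<le> \<delta>" using net by blast
      \<comment> \<open>Zones through \<open>x\<close> inject their poles into the wider slab of the
        nearby net point, whose count is already bounded.\<close>
      have imp: "u \<in> slab (r + \<delta>) y" if "x \<in> zone r u" for u
        using that near[of y x u] y(2) by (simp add: zone_def slab_def algebra_simps dist_commute)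
      have "card {Z \<in> set zs. x \<in> Z} \<le> length (filter (\<lambda>Z. x \<in> Z) zs)"
        using card_length[of "filter (\<lambda>Z. x \<in> Z) zs"] by simp
      also have "\<dots> = length (filter (\<lambda>u. x \<in> zone r u) us)"
        by (simp add: zs_def filter_map o_def)
      also have "\<dots> \<le> length (filter (\<lambda>u. u \<in> slab (r + \<delta>) y) us)"
        using imp by (induction us) auto
      finally show "real (card {Z \<in> set zs. x \<in> Z}) \<le> a" using few[OF y(1)] by linarith
    qed
  qed simp
qed

section \<open>Slab bounds in arbitrary directions\<close>

lemma slab_mono: "s \<le> s' \<Longrightarrow> slab s x \<subseteq> slab s' x"
  unfolding slab_def by (auto intro: order_trans[OF _ mult_right_mono])

lemma measure_slab_mono:
  fixes x :: "'a::euclidean_space"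
  assumes "s \<le> s'"
  shows "measure lborel (cball 0 1 \<inter> slab s x) \<le> measure lborel (cball 0 1 \<inter> slab s' x)"
proof (rule measure_mono_fmeasurable)
  show "cball 0 1 \<inter> slab s' x \<in> fmeasurable lborel"
    by (rule fmeasurableI2[OF fmeasurable_compact[OF compact_cball[of 0 1]]]) auto
qed (use slab_mono[OF assms] in auto)

text \<open>Rotation to a coordinate direction; the ratio of ball volumes makes the bound a multiple
  of the volume of the whole ball, hence a bound on a probability.\<close>

lemma measure_slab_ge:
  fixes x :: "real ^ 'd"
  assumes x: "norm x = 1" and s: "0 \<le> s" "s \<le> 1"
  defines "d \<equiv> CARD('d)"
  shows "s * (sqrt (real d / (2 * pi)) * unit_ball_vol (real d)) *
     (sqrt (1 - s\<^sup>2 / 4) ^ (d - 1) - (1 / 2) ^ (d - 1)) \<le> measure lborel (cball 0 1 \<inter> slab s x)"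
proof -
  obtain b :: "real ^ 'd" where b: "b \<in> Basis" using nonempty_Basis by blast
  have s2: "s\<^sup>2 \<le> 1" using s by (simp add: abs_square_le_1)
  have "1/2 \<le> sqrt (1 - s\<^sup>2 / 4)" using s2
    by (intro real_le_rsqrt) (simp add: power2_eq_square)
  then have "(1/2) ^ (d - 1) \<le> sqrt (1 - s\<^sup>2 / 4) ^ (d - 1)" by (intro power_mono) auto
  then have "s * (sqrt (real d / (2 * pi)) * unit_ball_vol (real d)) * (sqrt (1 - s\<^sup>2 / 4) ^ (d - 1) - (1 / 2) ^ (d - 1))
    \<le> s * unit_ball_vol (real (d - 1)) * (sqrt (1 - s\<^sup>2 / 4) ^ (d - 1) - (1 / 2) ^ (d - 1))"
    using s unit_ball_vol_ratio[of d] by (intro mult_right_mono mult_left_mono) (auto simp: d_def)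
  also have "\<dots> \<le> measure lborel (cball 0 1 \<inter> slab s b)"
    using measure_slab_Basis_ge[OF b s] by (simp add: d_def)
  also have "\<dots> = measure lborel (cball 0 1 \<inter> slab s x)"
    using x b by (intro measure_slab_rotate) auto
  finally show ?thesis .
qed

lemma measure_slab_le:
  fixes x :: "real ^ 'd"
  assumes x: "norm x = 1" and s: "0 \<le> s"
  shows "measure lborel (cball 0 1 \<inter> slab s x) \<le> s * 2 ^ CARD('d)"
proof -
  obtain b :: "real ^ 'd" where b: "b \<in> Basis" using nonempty_Basis by blast
  have "measure lborel (cball 0 1 \<inter> slab s x) = measure lborel (cball 0 1 \<inter> slab s b)"
    using x b by (intro measure_slab_rotate) auto
  also have "\<dots> \<le> s * 2 ^ CARD('d)"
    using measure_slab_Basis_le[OF b s] by simp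
  finally show ?thesis .
qed

text \<open>
  At \<open>s = 0\<close> the right-hand side exceeds \<open>d (1 - 2\<^bsup>-(d-1)\<^esup>)\<close>, which is at least \<open>d - 1\<close> because
  \<open>d \<le> 2\<^bsup>d-1\<^esup>\<close>.
\<close>

lemma eventually_slab_density:
  assumes d: "d \<ge> 1"
  shows "\<forall>\<^sub>F s in at_right 0. (real d - 1) \<le>
    (sqrt (2 * pi * real d) + 1/2) * sqrt (real d / (2 * pi)) *
      (sqrt (1 - s\<^sup>2 / 4) ^ (d - 1) - (1 / 2) ^ (d - 1))"
proof -
  let ?K = "(sqrt (2 * pi * real d) + 1/2) * sqrt (real d / (2 * pi))"
  obtain m where m: "d = Suc m" using d by (cases d) auto
  have lim: "((\<lambda>s::real. ?K * (sqrt (1 - s\<^sup>2 / 4) ^ (d - 1) - (1 / 2) ^ (d - 1))) \<longlongrightarrow>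
      ?K * (sqrt (1 - 0\<^sup>2 / 4) ^ (d - 1) - (1 / 2) ^ (d - 1))) (at_right 0)"
    by (intro tendsto_intros) auto
  have "sqrt (2 * pi * real d) * sqrt (real d / (2 * pi)) = real d"
    by (simp flip: real_sqrt_mult)
  then have K: "?K > real d" using d by (simp add: distrib_right)
  have "Suc m \<le> 2 ^ m" by (simp add: Suc_leI)
  then have "real (Suc m) \<le> 2 ^ m" by (metis of_nat_le_iff of_nat_numeral of_nat_power)
  then have "real d * (1/2) ^ m \<le> 1" by (simp add: m power_one_over field_simps)
  then have "real d - 1 \<le> real d * (1 - (1/2) ^ m)" by (simp add: right_diff_distrib)
  show ?thesis
  \<comment> \<open>The limit argument needs strict inequality at \<open>s = 0\<close>; for
    \<open>m = 0\<close> both sides of the claim are 0.\<close>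
  proof (cases "m = 0")
    case False
    then have "(1/2::real) ^ m < 1" by (simp add: power_less_one_iff)
    then have "real d * (1 - (1/2) ^ m) < ?K * (1 - (1 / 2) ^ m)"
      by (intro mult_strict_right_mono K) simp
    with \<open>real d - 1 \<le> _\<close> have "real d - 1 < ?K * (sqrt (1 - 0\<^sup>2 / 4) ^ (d - 1) - (1 / 2) ^ (d - 1))"
      by (simp add: m)
    from order_tendstoD(1)[OF lim this] show ?thesis
      by (rule eventually_mono) simp
  qed (simp add: m)
qed

section \<open>Choice of parameters and the limit in \<open>n\<close>\<close>

text \<open>All demands on the size of \<open>n\<close> are hypotheses here, so only limits remain
  to be checked afterwards. The sphere net has mesh \<open>L / 4\<close> and the zones have
  \<open>r = sin (m * L)\<close>.\<close>

lemma ex_zone_covering: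
  assumes n: "n \<ge> 3"
    and d: "d = CARD('d::finite)" "d \<ge> 2"
    and L: "L = ln (real n) / real n" and V: "V = unit_ball_vol (real d)"
    and m: "m = m_const d" and K: "K = (m + 1) * 2 ^ d / V"
    and C: "C = real d * 4 ^ d * 4 ^ (d - 1)"
    and small: "m * L < pi / 2" "m * L \<le> 1" "real d * L \<le> 1"
    and sin: "(m - 1/4) * L \<le> sin (m * L)"
    and dens: "real d - 1 \<le> (sqrt (2 * pi * real d) + 1/2) * sqrt (real d / (2 * pi)) *
      (sqrt (1 - ((m - 1/2) * L)\<^sup>2 / 4) ^ (d - 1) - (1 / 2) ^ (d - 1))"
    and C1: "C / ln (real n) ^ (d - 1) < 1/2" and C2: "C / real n < 1/2"
  shows "\<exists>F :: (real ^ 'd) set set.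
        finite F \<and> card F = n \<and> (\<forall>Z\<in>F. is_zone (m * L) Z) \<and> \<Union>F = sphere 0 1 \<and>
        (\<forall>x\<in>sphere 0 1. real (card {Z\<in>F. x \<in> Z}) \<le> (2 * K + real d) * ln (real n))"
proof -
  have "exp 1 \<le> real n" using exp_le n by linarith
  then have ln1: "ln (real n) \<ge> 1" using n by (subst ln_ge_iff) auto
  have L0: "L > 0" using ln1 n by (simp add: L)
  have nL: "real n * L = ln (real n)" using n by (simp add: L)
  have m1: "m > 1" using d by (simp add: m m_const_def)
  have V0: "V > 0" by (simp add: V)
  have K0: "K > 0" using m1 V0 by (simp add: K)
  have "L \<le> m * L" using m1 L0 by simp
  then have L1: "L / 4 \<le> 1" using small(2) L0 by linarith
  have mL: "0 < m * L" using m1 L0 by simp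
  define r where "r = sin (m * L)"
  have r1: "r < 1"
    unfolding r_def using small(1) mL sin_monotone_2pi[of "m * L" "pi/2"] pi_gt_zero by simp
  have "0 < (m - 1/4) * L" using m1 L0 by simp
  then have r0: "0 < r" using sin by (simp add: r_def)
  have rle: "r \<le> m * L" unfolding r_def using m1 L0 by (intro sin_x_le_x) auto
  obtain N :: "(real ^ 'd) set" where N: "finite N" "N \<subseteq> sphere 0 1"
    "\<forall>x\<in>sphere 0 1. \<exists>y\<in>N. dist x y \<le> L / 4" "real (card N) * (L / 4) ^ (d - 1) \<le> real d * 4 ^ d"
    using exists_sphere_net[of "L/4", where 'a = "real ^ 'd"] L0 L1 by (auto simp: d)
  have "real (card N) * L ^ (d - 1) \<le> C"
    using N(4) by (simp add: C power_divide field_simps)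
  then have "real (card N) \<le> C / L ^ (d - 1)" using L0 by (simp add: field_simps)
  also have "\<dots> = C / ln (real n) ^ (d - 1) * real n ^ (d - 1)"
    by (simp add: L power_divide)
  finally have cN: "real (card N) \<le> C / ln (real n) ^ (d - 1) * real n ^ (d - 1)" .
  \<comment> \<open>Since \<open>n * p = (d - 1) * ln n\<close>, the probability of a miss is at
    most \<open>1 / n ^ (d - 1)\<close>, which cancels the net size up to a power of
    \<open>ln n\<close>.\<close>
  define p where "p = (real d - 1) * L"
  define q where "q = K * L"
  \<comment> \<open>As \<open>exp 1 - 1\<close> is at most 2, the exponential moment is at most
    \<open>exp (2 * K * ln n)\<close>. The additional \<open>d * ln n\<close> gives a factor
    \<open>1 / n ^ d\<close>, which beats the net size.\<close>
  define a where "a = (2 * K + real d) * ln (real n)"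
  have C0: "C > 0" using d by (simp add: C)
  have ed: "exp (- (real k * ln (real n))) = 1 / real n ^ k" for k
    using n by (simp add: exp_minus exp_of_nat_mult field_simps)
  have dm: "real d - 1 = real (d - 1)" using d by simp
  have "p \<le> real d * L" unfolding p_def using L0 by (intro mult_right_mono) auto
  then have "p \<le> 1" using small(3) by linarith
  then have "(1 - p) ^ n \<le> exp (- p) ^ n" 
    using exp_ge_add_one_self[of "- p"] by (intro power_mono) auto
  also have "\<dots> = exp (- (real (d - 1) * ln (real n)))"
    by (simp add: exp_of_nat_mult[symmetric] p_def dm nL[symmetric] mult_ac)
  finally have "real (card N) * (1 - p) ^ n \<le> real (card N) * (1 / real n ^ (d - 1))"
    unfolding ed by (intro mult_left_mono) auto
  also have "\<dots> \<le> C / ln (real n) ^ (d - 1)"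
    using cN n by (simp add: field_simps)
  finally have t1: "real (card N) * (1 - p) ^ n < 1/2" using C1 by linarith
  have q0: "q \<ge> 0" using K0 L0 by (simp add: q_def)
  have "(1 + (exp 1 - 1) * q) \<le> exp ((exp 1 - 1) * q)" by (rule exp_ge_add_one_self)
  also have "\<dots> \<le> exp (2 * q)" using exp_le q0 by (simp add: mult_right_mono)
  finally have "(1 + (exp 1 - 1) * q) ^ n \<le> exp (2 * q) ^ n" using q0 by (intro power_mono) auto
  also have "\<dots> = exp (2 * K * ln (real n))"
    by (simp add: exp_of_nat_mult[symmetric] q_def nL[symmetric] mult_ac)
  finally have "exp (- a) * (1 + (exp 1 - 1) * q) ^ n \<le> exp (- a) * exp (2 * K * ln (real n))"
    by (intro mult_left_mono) auto
  also have "\<dots> = exp (- (real d * ln (real n)))" by (simp add: exp_add[symmetric] a_def algebra_simps)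
  finally have "real (card N) * (exp (- a) * (1 + (exp 1 - 1) * q) ^ n) \<le>
      C / ln (real n) ^ (d - 1) * real n ^ (d - 1) * (1 / real n ^ d)"
    unfolding ed using q0 C0 ln1 by (intro mult_mono cN) auto
  also have "\<dots> = C / real n / ln (real n) ^ (d - 1)"
  proof -
    have "real n ^ d = real n * real n ^ (d - 1)" using d(2) by (cases d) auto
    then show ?thesis using n by simp
  qed
  also have "\<dots> \<le> C / real n / 1 ^ (d - 1)"
    using ln1 C0 n by (intro divide_left_mono power_mono) auto
  finally have "real (card N) * (exp (- a) * (1 + (exp 1 - 1) * q) ^ n) \<le> C / real n" by simp
  then have t2: "real (card N) * (exp (- a) * (1 + (exp 1 - 1) * q) ^ n) < 1/2"
    using C2 by linarith
  \<comment> \<open>The summand 1 in \<open>m\<close> is spent as follows: 1/4 on replacing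
    \<open>m * L\<close> by its sine, 1/4 on the mesh, and 1/2 stays as slack for the density
    estimate.\<close>
  have s: "0 \<le> (m - 1/2) * L" "(m - 1/2) * L \<le> 1" "(m - 1/2) * L \<le> r - L / 4" "r + L / 4 \<le> (m + 1) * L"
    using m1 L0 small(2) sin rle by (simp_all add: r_def algebra_simps)
  have "\<exists>F. finite F \<and> card F = n \<and> (\<forall>Z\<in>F. \<exists>u::real ^ 'd. u \<noteq> 0 \<and> Z = zone r u) \<and>
    \<Union>F = sphere 0 1 \<and> (\<forall>x\<in>sphere 0 1. real (card {Z\<in>F. x \<in> Z}) \<le> a)"
  proof (rule exists_zone_family[of N "L/4" r p q])
    fix x assume x: "x \<in> N"
    then have nx: "norm x = 1" using N by auto
    have "p * unit_ball_vol (real CARD('d)) = L * (V * (real d - 1))" by (simp add: p_def V d)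
    also have "\<dots> \<le> L * (V * ((sqrt (2 * pi * real d) + 1/2) * sqrt (real d / (2 * pi)) *
      (sqrt (1 - ((m - 1/2) * L)\<^sup>2 / 4) ^ (d - 1) - (1 / 2) ^ (d - 1))))"
      using L0 V0 dens by (intro mult_left_mono) auto
    also have "\<dots> = (m - 1/2) * L * (sqrt (real d / (2 * pi)) * V) *
      (sqrt (1 - ((m - 1/2) * L)\<^sup>2 / 4) ^ (d - 1) - (1 / 2) ^ (d - 1))"
      by (simp add: m m_const_def mult_ac)
    also have "\<dots> \<le> measure lborel (cball 0 1 \<inter> slab ((m - 1/2) * L) x)"
      using measure_slab_ge[OF nx s(1,2)] by (simp add: V d)
    also have "\<dots> \<le> measure lborel (cball 0 1 \<inter> slab (r - L / 4) x)"
      by (rule measure_slab_mono[OF s(3)])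
    finally show "p * unit_ball_vol (real CARD('d)) \<le> measure lborel (cball 0 1 \<inter> slab (r - L / 4) x)" .
    have "measure lborel (cball 0 1 \<inter> slab (r + L / 4) x) \<le> measure lborel (cball 0 1 \<inter> slab ((m + 1) * L) x)"
      by (rule measure_slab_mono[OF s(4)])
    also have "\<dots> \<le> (m + 1) * L * 2 ^ CARD('d)"
      using m1 L0 by (intro measure_slab_le[OF nx]) auto
    also have "\<dots> = q * unit_ball_vol (real CARD('d))"
      using V0 by (simp add: q_def K flip: V d(1))
    finally show "measure lborel (cball 0 1 \<inter> slab (r + L / 4) x) \<le> q * unit_ball_vol (real CARD('d))" .
  next
    show "real (card N) * ((1 - p) ^ n + exp (- a) * (1 + (exp 1 - 1) * q) ^ n) < 1"
      using t1 t2 by (simp add: distrib_left)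
  qed (use N d r0 r1 in auto)
  then obtain F where F: "finite F" "card F = n" "\<forall>Z\<in>F. \<exists>u::real ^ 'd. u \<noteq> 0 \<and> Z = zone r u"
    "\<Union>F = sphere 0 1" "\<forall>x\<in>sphere 0 1. real (card {Z\<in>F. x \<in> Z}) \<le> a" by blast
  have "is_zone (m * L) Z" if "Z \<in> F" for Z
    using F(3) that is_zone_zone[where t = "m * L" and 'a = "real ^ 'd"] d m1 L0 small(1)
    by (force simp: r_def)
  then show ?thesis using F by (intro exI[of _ F]) (auto simp: a_def)
qed

text \<open>With \<open>d\<close> fixed, \<open>ln n / n\<close> tends to 0 and \<open>ln n\<close>
  to infinity, so every hypothesis of \<open>ex_zone_covering\<close> holds eventually. The constant
  is \<open>2 * K + d\<close>, where \<open>K\<close> depends on \<open>d\<close> only.\<close>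

theorem theorem3:
  assumes "CARD('d::finite) \<ge> 3"
  shows "\<exists>A::real. A > 0 \<and>
    (\<forall>\<^sub>F n in sequentially.
      \<exists>F :: (real ^ 'd) set set.
        finite F \<and> card F = n \<and>
        (\<forall>Z\<in>F. is_zone (m_const CARD('d) * (ln (real n) / real n)) Z) \<and>
        \<Union>F = sphere 0 1 \<and>
        (\<forall>x\<in>sphere 0 1. real (card {Z\<in>F. x \<in> Z}) \<le> A * ln (real n)))"
proof -
  define d where "d = CARD('d)"
  define m where "m = m_const d"
  define V where "V = unit_ball_vol (real d)"
  define K where "K = (m + 1) * 2 ^ d / V"
  define C where "C = real d * 4 ^ d * 4 ^ (d - 1)"
  have d: "d \<ge> 3" using assms by (simp add: d_def)
  have m1: "m > 1" using d by (simp add: m_def m_const_def)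
  have V0: "V > 0" by (simp add: V_def)
  have K0: "K > 0" using m1 V0 by (simp add: K_def)
  have L: "((\<lambda>n. c * (ln (real n) / real n)) \<longlongrightarrow> 0) sequentially" for c by real_asymp
  \<comment> \<open>The sine differs from its argument by a cubic term, eventually less than a
    quarter of \<open>ln n / n\<close>.\<close>
  have ev_sin: "\<forall>\<^sub>F n in sequentially. (m - 1/4) * (ln (real n) / real n) \<le> sin (m * (ln (real n) / real n))"
    using m1 by real_asymp
  \<comment> \<open>The density estimate is known near 0 from the right, so the slab widths must
    approach 0 through positive values.\<close>
  have "filterlim (\<lambda>n. (m - 1/2) * (ln (real n) / real n)) (at_right 0) sequentially"
    using m1 by real_asymp
  from eventually_compose_filterlim[OF eventually_slab_density this, of d]
  have ev_dens: "\<forall>\<^sub>F n in sequentially. real d - 1 \<le> (sqrt (2 * pi * real d) + 1/2) * sqrt (real d / (2 * pi)) *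
      (sqrt (1 - ((m - 1/2) * (ln (real n) / real n))\<^sup>2 / 4) ^ (d - 1) - (1 / 2) ^ (d - 1))"
    using d by simp
  have "((\<lambda>n. C / ln (real n) ^ (d - 1)) \<longlongrightarrow> 0) sequentially"
  proof (rule real_tendsto_divide_at_top[OF tendsto_const])
    show "filterlim (\<lambda>n. ln (real n) ^ (d - 1)) at_top sequentially"
      using d by (intro filterlim_pow_at_top) (simp, real_asymp)
  qed
  then have ev_C1: "\<forall>\<^sub>F n in sequentially. C / ln (real n) ^ (d - 1) < 1/2"
    by (rule order_tendstoD) simp
  have "((\<lambda>n. C / real n) \<longlongrightarrow> 0) sequentially" by real_asymp
  then have ev_C2: "\<forall>\<^sub>F n in sequentially. C / real n < 1/2"
    by (rule order_tendstoD) simp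
  have "\<forall>\<^sub>F n in sequentially. \<exists>F :: (real ^ 'd) set set.
        finite F \<and> card F = n \<and> (\<forall>Z\<in>F. is_zone (m * (ln (real n) / real n)) Z) \<and> \<Union>F = sphere 0 1 \<and>
        (\<forall>x\<in>sphere 0 1. real (card {Z\<in>F. x \<in> Z}) \<le> (2 * K + real d) * ln (real n))"
    using eventually_ge_at_top[of 3] ev_sin ev_dens ev_C1 ev_C2
      order_tendstoD(2)[OF L[of m] pi_half_gt_zero] order_tendstoD(2)[OF L[of m] zero_less_one]
      order_tendstoD(2)[OF L[of "real d"] zero_less_one]
  proof eventually_elim
    case (elim n)
    show ?case
      by (rule ex_zone_covering[OF elim(1) d_def _ refl V_def m_def K_def C_def]) (use elim d in auto)
  qed
  then show ?thesis
    using K0 d unfolding m_def d_def by (intro exI[of _ "2 * K + real CARD('d)"] conjI) auto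
qed

end
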